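(* Let $X\subset\mathbb{R}^N$ and $Y\subset\mathbb{R}^P$ be locally finite geometric simplicial complexes, let $f\colon X\to Y$ be a surjective simplicial map with finite fibres, and let $k\ge 1$. Then the collection of geometric simplices $\{\Gamma^{(k)}_{\mathbf{x}} : \mathbf{x}\in W^k(f)\}$ gives $W^k(f)$ the structure of a simplicial complex.
   Context: A simplicial map sends the vertices of each simplex to vertices of a simplex and is affine on each simplex. $W^k(f)=\{(x_1,\dots,x_k)\in X^k : f(x_1)=\dots=f(x_k)\}\subset(\mathbb{R}^N)^k$; $\pi_\ell$ is the $\ell$-th projection to $X$. For a point $x$ of a simplicial complex, $\Gamma_x$ is the unique geometric simplex containing $x$ in its interior. For $\mathbf{x}\in W^k(f)$ put $y=f(\pi_1(\mathbf{x}))$ and let $w_0,\dots,w_n$ be the vertices of $\Gamma_y$. For each $\ell$, $f$ maps $\Gamma_{\pi_\ell(\mathbf{x})}$ isomorphically onto $\Gamma_y$; let $v^{(\ell)}_j$ be the vertex of $\Gamma_{\pi_\ell(\mathbf{x})}$ with $f(v^{(\ell)}_j)=w_j$. Then $\Gamma^{(k)}_{\mathbf{x}}\subset(\mathbb{R}^N)^k$ is the geometric $n$-simplex with vertices $(v^{(1)}_j,\dots,v^{(k)}_j)$, $j=0,\dots,n$. *)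

theory Defs
  imports "HOL-Analysis.Analysis"
begin

text \<open>The library's \<open>simplicial_complex\<close> forces the collection to be finite and to contain the
  empty simplex. Below the collection is arbitrary and its simplices are nonempty; note that
  \<open>face_of\<close> admits the empty face, so two simplices of a complex may be disjoint.\<close>

definition geometric_complex :: "'a::euclidean_space set set \<Rightarrow> bool" where
  "geometric_complex K \<longleftrightarrow>
     (\<forall>S\<in>K. \<exists>n::nat. int n simplex S) \<and>
     (\<forall>S\<in>K. \<forall>F. F face_of S \<and> F \<noteq> {} \<longrightarrow> F \<in> K) \<and>
     (\<forall>S\<in>K. \<forall>S'\<in>K. (S \<inter> S') face_of S \<and> (S \<inter> S') face_of S')"

definition locally_finite_complex :: "'a::euclidean_space set set \<Rightarrow> bool" where
  "locally_finite_complex K \<longleftrightarrow>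
     geometric_complex K \<and>
     (\<forall>x\<in>\<Union>K. \<exists>U. open U \<and> x \<in> U \<and> finite {S\<in>K. S \<inter> U \<noteq> {}})"

text \<open>\<open>K\<close> makes the space \<open>W\<close> (with its subspace topology) a simplicial complex: \<open>W\<close> is the
  underlying set, and its topology is the weak topology determined by the simplices.\<close>

definition simplicial_structure_on :: "'a::euclidean_space set set \<Rightarrow> 'a set \<Rightarrow> bool" where
  "simplicial_structure_on K W \<longleftrightarrow>
     geometric_complex K \<and>
     \<Union>K = W \<and>
     (\<forall>A\<subseteq>W. closedin (top_of_set W) A \<longleftrightarrow> (\<forall>S\<in>K. closed (A \<inter> S)))"

definition vertices :: "'a::euclidean_space set \<Rightarrow> 'a set" where
  "vertices S = {v. v extreme_point_of S}"

text \<open>Only the values of \<open>f\<close> on \<open>\<Union>K\<close> are relevant.\<close>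

definition simplicial_map ::
  "'a::euclidean_space set set \<Rightarrow> 'b::euclidean_space set set \<Rightarrow> ('a \<Rightarrow> 'b) \<Rightarrow> bool" where
  "simplicial_map K L f \<longleftrightarrow>
     (\<forall>S\<in>K. (\<exists>T\<in>L. f ` vertices S \<subseteq> vertices T) \<and>
            (\<exists>h c. linear h \<and> (\<forall>x\<in>S. f x = h x + c)))"

definition carrier_simplex :: "'a::euclidean_space set set \<Rightarrow> 'a \<Rightarrow> 'a set" where
  "carrier_simplex K x = (THE S. S \<in> K \<and> x \<in> rel_interior S)"

text \<open>A point of \<open>X\<^sup>k\<close> is a vector \<open>x :: 'a ^ 'k\<close> with \<open>k = CARD('k)\<close>, and \<open>x $ l\<close> is its
  \<open>l\<close>-th projection.\<close>

definition multi_point_space :: "'a set \<Rightarrow> ('a \<Rightarrow> 'b) \<Rightarrow> ('a ^ 'k) set" where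
  "multi_point_space X f = {x. (\<forall>l. x $ l \<in> X) \<and> (\<forall>l m. f (x $ l) = f (x $ m))}"

definition common_value :: "('a \<Rightarrow> 'b) \<Rightarrow> 'a ^ 'k \<Rightarrow> 'b" where
  "common_value f x = (THE y. \<forall>l. f (x $ l) = y)"

definition lifted_vertex ::
  "'a::euclidean_space set set \<Rightarrow> ('a \<Rightarrow> 'b) \<Rightarrow> 'a \<Rightarrow> 'b \<Rightarrow> 'a" where
  "lifted_vertex K f x w = (THE v. v \<in> vertices (carrier_simplex K x) \<and> f v = w)"

definition multi_simplex ::
  "'a::euclidean_space set set \<Rightarrow> 'b::euclidean_space set set \<Rightarrow> ('a \<Rightarrow> 'b) \<Rightarrow> 'a ^ 'k
    \<Rightarrow> ('a ^ 'k) set" where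
  "multi_simplex K L f x =
     convex hull {(\<chi> l. lifted_vertex K f (x $ l) w) | w.
                    w \<in> vertices (carrier_simplex L (common_value f x))}"

end

theory Submission
  imports Defs
begin

text \<open>Finite fibres make \<open>f\<close> injective on each simplex \<open>S\<close> of \<open>K\<close>, since a fibre of an affine map
  on a convex set is convex; so \<open>f\<close> maps \<open>S\<close> isomorphically onto a simplex of \<open>L\<close>. It follows that
  \<open>multi_simplex K L f x\<close> is the fibre product over \<open>f\<close> of the carriers of the coordinates of \<open>x\<close>,
  that is, the part of the product of the carriers lying in \<open>W\<close>, and that each coordinate
  projection maps it isomorphically onto the corresponding carrier. Being a simplex and
  being in the relative interior are therefore read off in one coordinate, whereas
  intersections and local finiteness are read off coordinatewise from \<open>K\<close>.\<close>

section \<open>Simplices and geometric complexes\<close>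

lemma vertices_convex_hull:
  fixes C :: "'a::euclidean_space set"
  assumes "\<not> affine_dependent C"
  shows "vertices (convex hull C) = C"
  using extreme_point_of_convex_hull_affine_independent[OF assms] by (auto simp: vertices_def)

lemma simplex_vertices:
  fixes S :: "'a::euclidean_space set"
  assumes "n simplex S"
  shows "\<not> affine_dependent (vertices S)" "convex hull (vertices S) = S"
    "int (card (vertices S)) = n + 1"
  using assms vertices_convex_hull unfolding simplex_def by metis+

text \<open>Discarding the vertices with vanishing barycentric coordinate leaves a face in which all
  coordinates of \<open>x\<close> are positive, and positivity describes the relative
  interior.\<close>

lemma simplex_carrier_face:
  fixes S :: "'a::euclidean_space set"
  assumes "n simplex S" and "x \<in> S"
  obtains F where "F face_of S" "x \<in> rel_interior F"
proof -
  let ?C = "vertices S"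
  have ind: "\<not> affine_dependent ?C" and hull: "convex hull ?C = S"
    using simplex_vertices[OF assms(1)] by auto
  have fin: "finite ?C" using ind by (rule aff_independent_finite)
  obtain u where u: "\<forall>v\<in>?C. 0 \<le> u v" "sum u ?C = 1" "(\<Sum>v\<in>?C. u v *\<^sub>R v) = x"
    using assms(2) hull convex_hull_finite[OF fin] by fastforce
  define D where "D = {v \<in> ?C. u v \<noteq> 0}"
  have D: "D \<subseteq> ?C" "\<not> affine_dependent D"
    using affine_independent_subset[OF ind] by (auto simp: D_def)
  have "sum u D = 1" "(\<Sum>v\<in>D. u v *\<^sub>R v) = x"
    using u(2,3) sum.mono_neutral_left[OF fin D(1), of u]
      sum.mono_neutral_left[OF fin D(1), of "\<lambda>v. u v *\<^sub>R v"]
    by (auto simp: D_def)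
  moreover have "\<forall>v\<in>D. 0 < u v" using u(1) by (force simp: D_def)
  ultimately have "x \<in> rel_interior (convex hull D)"
    using rel_interior_convex_hull_explicit[OF D(2)] by auto
  moreover have "convex hull D face_of S"
    using face_of_convex_hull_affine_independent[OF ind] D(1) hull by auto
  ultimately show thesis using that by blast
qed

lemma geometric_complex_simplex:
  assumes "geometric_complex K" "S \<in> K"
  obtains n :: nat where "int n simplex S"
  using assms by (auto simp: geometric_complex_def)

lemma geometric_complex_convex:
  "\<lbrakk>geometric_complex K; S \<in> K\<rbrakk> \<Longrightarrow> convex S"
  by (metis geometric_complex_simplex convex_simplex)

lemma geometric_complex_compact:
  "\<lbrakk>geometric_complex K; S \<in> K\<rbrakk> \<Longrightarrow> compact S"
  by (metis geometric_complex_simplex compact_simplex)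

lemma geometric_complex_nonempty:
  "\<lbrakk>geometric_complex K; S \<in> K\<rbrakk> \<Longrightarrow> S \<noteq> {}"
  by (force elim: geometric_complex_simplex)

lemma geometric_complex_vertices:
  assumes "geometric_complex K" "S \<in> K"
  shows "\<not> affine_dependent (vertices S)" "convex hull (vertices S) = S"
  using assms by (metis geometric_complex_simplex simplex_vertices)+

lemma vertices_subset: "vertices S \<subseteq> S"
  by (auto simp: vertices_def extreme_point_of_def)

text \<open>A face that meets the relative interior is everything; \<open>S \<inter> T\<close> is
  such a face of both simplices.\<close>

lemma geometric_complex_rel_interior_unique:
  assumes "geometric_complex K" "S \<in> K" "T \<in> K" "x \<in> rel_interior S" "x \<in> rel_interior T"
  shows "S = T"
proof -
  have "S \<inter> T face_of S" "S \<inter> T face_of T"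
    using assms(1-3) by (auto simp: geometric_complex_def)
  moreover have "x \<in> S \<inter> T" using assms(4,5) rel_interior_subset by blast
  ultimately have "S \<inter> T = S" "S \<inter> T = T"
    using assms(4,5) face_of_disjoint_rel_interior by blast+
  then show ?thesis by simp
qed

lemma carrier_simplex_eqI:
  assumes "geometric_complex K" "S \<in> K" "x \<in> rel_interior S"
  shows "carrier_simplex K x = S"
  unfolding carrier_simplex_def
  using assms geometric_complex_rel_interior_unique by (intro the_equality) blast+

text \<open>Existence behind the definite description: the face with \<open>x\<close> in its
  relative interior again belongs to the complex.\<close>

lemma carrier_simplex:
  assumes K: "geometric_complex K" and "x \<in> \<Union>K"
  shows "carrier_simplex K x \<in> K" "x \<in> rel_interior (carrier_simplex K x)"
proof -
  obtain S where S: "S \<in> K" "x \<in> S" using assms(2) by blast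
  obtain n :: nat where "int n simplex S" using geometric_complex_simplex[OF K S(1)] .
  then obtain F where F: "F face_of S" "x \<in> rel_interior F" using S(2) simplex_carrier_face by blast
  then have "F \<noteq> {}" by auto
  then have "F \<in> K" using K S(1) F(1) by (auto simp: geometric_complex_def)
  then show "carrier_simplex K x \<in> K" "x \<in> rel_interior (carrier_simplex K x)"
    using F(2) carrier_simplex_eqI[OF K] by auto
qed

lemma mem_carrier_simplex:
  "\<lbrakk>geometric_complex K; x \<in> \<Union>K\<rbrakk> \<Longrightarrow> x \<in> carrier_simplex K x"
  using carrier_simplex(2) rel_interior_subset by blast

text \<open>Linear maps commute with affine hulls, so a dependence in \<open>C\<close> is pushed
  forward. Injectivity is asked on \<open>C\<close> alone because the lemma serves a coordinate
  projection.\<close>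

lemma affine_independent_inj_linear_image:
  fixes h :: "'a::euclidean_space \<Rightarrow> 'b::euclidean_space"
  assumes h: "linear h" "inj_on h C" and ind: "\<not> affine_dependent (h ` C)"
  shows "\<not> affine_dependent C"
proof
  assume "affine_dependent C"
  then obtain x where x: "x \<in> C" "x \<in> affine hull (C - {x})" by (auto simp: affine_dependent_def)
  have "h x \<in> affine hull (h ` (C - {x}))"
    using x(2) affine_hull_linear_image[of h "C - {x}"] h(1) by (auto simp: linear_linear)
  moreover have "h ` (C - {x}) = h ` C - {h x}"
    using h(2) x(1) by (auto simp: inj_on_def)
  ultimately show False using x(1) ind by (auto simp: affine_dependent_def)
qed

section \<open>Fibre products of simplices\<close>

text \<open>The factors form an arbitrary family, so that products over different families can be
  intersected; the constant family \<open>X\<close> gives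
  \<open>multi_point_space X f\<close>.\<close>

definition fibre_product :: "('a \<Rightarrow> 'b) \<Rightarrow> ('k \<Rightarrow> 'a set) \<Rightarrow> ('a ^ 'k) set" where
  "fibre_product f \<sigma> = {z. (\<forall>l. z $ l \<in> \<sigma> l) \<and> (\<forall>l m. f (z $ l) = f (z $ m))}"

lemma common_value_eq:
  "\<forall>l m. f (x $ l) = f (x $ m) \<Longrightarrow> common_value f x = f (x $ l)"
  unfolding common_value_def by (rule the_equality) auto

text \<open>Injectivity on each simplex is the form in which finiteness of the fibres enters the
  argument.\<close>

locale simplexwise_injective_map =
  fixes K :: "'a::euclidean_space set set" and L :: "'b::euclidean_space set set"
    and f :: "'a \<Rightarrow> 'b"
  assumes K: "geometric_complex K" and L: "geometric_complex L"
    and f: "simplicial_map K L f"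
    and inj: "S \<in> K \<Longrightarrow> inj_on f S"
begin

section \<open>Images of simplices under the simplicial map\<close>

lemma affine_on_simplex:
  assumes "S \<in> K"
  obtains h c where "linear h" "\<forall>x\<in>S. f x = c + h x"
proof -
  obtain h c where "linear h" "\<forall>x\<in>S. f x = h x + c"
    using f assms unfolding simplicial_map_def by blast
  then show thesis using that[of h c] by (simp add: add.commute)
qed

lemma image_convex_combination:
  assumes "S \<in> K" "a \<in> S" "b \<in> S" "0 \<le> u" "0 \<le> v" "u + v = 1"
  shows "f (u *\<^sub>R a + v *\<^sub>R b) = u *\<^sub>R f a + v *\<^sub>R f b"
proof -
  obtain h c where h: "linear h" "\<forall>x\<in>S. f x = c + h x"
    by (rule affine_on_simplex[OF assms(1)])
  have "u *\<^sub>R a + v *\<^sub>R b \<in> S"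
    using geometric_complex_convex[OF K assms(1)] assms(2-) by (simp add: convexD)
  moreover have "c = u *\<^sub>R c + v *\<^sub>R c" using assms(6) by (metis scaleR_left_distrib scaleR_one)
  ultimately show ?thesis
    using h assms(2,3) by (simp add: linear_add linear_scale algebra_simps)
qed

lemma image_rel_interior:
  assumes "S \<in> K"
  shows "f ` rel_interior S = rel_interior (f ` S)"
proof -
  obtain h c where h: "linear h" "\<forall>x\<in>S. f x = c + h x"
    by (rule affine_on_simplex[OF assms])
  have eq: "f ` A = (+) c ` h ` A" if "A \<subseteq> S" for A
    using that h(2) by (force simp: image_image)
  show ?thesis
    using eq[OF rel_interior_subset] eq[of S] rel_interior_translation[of c "h ` S"]
      rel_interior_convex_linear_image[OF h(1) geometric_complex_convex[OF K assms]]
    by simp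
qed

lemma image_eq_convex_hull:
  assumes "S \<in> K"
  shows "f ` S = convex hull (f ` vertices S)"
proof -
  obtain h c where h: "linear h" "\<forall>x\<in>S. f x = c + h x"
    by (rule affine_on_simplex[OF assms])
  have eq: "f ` A = (+) c ` h ` A" if "A \<subseteq> S" for A
    using that h(2) by (force simp: image_image)
  show ?thesis
    using eq[OF vertices_subset] eq[of S] convex_hull_translation[of c "h ` vertices S"]
      convex_hull_linear_image[OF h(1), of "vertices S"] geometric_complex_vertices(2)[OF K assms]
    by simp
qed

text \<open>The image is the hull of some vertices of a simplex \<open>T\<close> of
  \<open>L\<close>, hence a face of \<open>T\<close>; those vertices are affinely independent, so
  they are exactly the vertices of the image.\<close>

lemma image_simplex:
  assumes "S \<in> K"
  shows "f ` S \<in> L" "vertices (f ` S) = f ` vertices S"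
proof -
  obtain T where T: "T \<in> L" "f ` vertices S \<subseteq> vertices T"
    using f assms unfolding simplicial_map_def by blast
  have "f ` S face_of convex hull (vertices T)"
    using face_of_convex_hull_affine_independent[OF geometric_complex_vertices(1)[OF L T(1)]] T(2)
      image_eq_convex_hull[OF assms] by auto
  then have "f ` S face_of T" using geometric_complex_vertices(2)[OF L T(1)] by simp
  then show "f ` S \<in> L"
    using L T(1) geometric_complex_nonempty[OF K assms] by (auto simp: geometric_complex_def)
  have "\<not> affine_dependent (f ` vertices S)"
    using affine_independent_subset[OF geometric_complex_vertices(1)[OF L T(1)] T(2)] .
  then show "vertices (f ` S) = f ` vertices S"
    using vertices_convex_hull image_eq_convex_hull[OF assms] by metis
qed

lemma carrier_simplex_image:
  assumes "x \<in> \<Union>K"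
  shows "carrier_simplex L (f x) = f ` carrier_simplex K x"
proof (rule carrier_simplex_eqI[OF L])
  show "f ` carrier_simplex K x \<in> L"
    using image_simplex(1) carrier_simplex(1)[OF K assms] .
  show "f x \<in> rel_interior (f ` carrier_simplex K x)"
    using carrier_simplex[OF K assms] image_rel_interior by blast
qed

section \<open>Convexity, projections and faces of fibre products\<close>

lemma convex_fibre_product:
  fixes \<sigma> :: "'k::finite \<Rightarrow> 'a set"
  assumes "\<And>l. \<sigma> l \<in> K"
  shows "convex (fibre_product f \<sigma>)"
proof (rule convexI)
  fix a b :: "'a ^ 'k" and u v :: real
  assume ab: "a \<in> fibre_product f \<sigma>" "b \<in> fibre_product f \<sigma>" and uv: "0 \<le> u" "0 \<le> v" "u + v = 1"
  obtain p q where pq: "\<And>l. f (a $ l) = p" "\<And>l. f (b $ l) = q"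
    using ab by (simp add: fibre_product_def) blast
  \<comment> \<open>As \<open>f\<close> is affine on \<open>\<sigma> l\<close>, the value is
    expressed by \<open>p\<close> and \<open>q\<close> alone and so agrees in all
    coordinates.\<close>
  have "f (u *\<^sub>R a $ l + v *\<^sub>R b $ l) = u *\<^sub>R p + v *\<^sub>R q" for l
    using image_convex_combination[OF assms[of l], of "a $ l" "b $ l"] ab uv pq
    by (simp add: fibre_product_def)
  moreover have "u *\<^sub>R a $ l + v *\<^sub>R b $ l \<in> \<sigma> l" for l
    using convexD[OF geometric_complex_convex[OF K assms[of l]]] ab uv by (auto simp: fibre_product_def)
  ultimately show "u *\<^sub>R a + v *\<^sub>R b \<in> fibre_product f \<sigma>"
    by (simp add: fibre_product_def)
qed

text \<open>One coordinate fixes the common value of \<open>f\<close>, and injectivity on each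
  \<open>\<sigma> m\<close> then fixes every other coordinate.\<close>

lemma inj_on_fibre_product_nth:
  assumes "\<And>l. \<sigma> l \<in> K"
  shows "inj_on (\<lambda>z. z $ l) (fibre_product f \<sigma>)"
proof (rule inj_onI)
  fix a b assume ab: "a \<in> fibre_product f \<sigma>" "b \<in> fibre_product f \<sigma>" and eq: "a $ l = b $ l"
  have "a $ m \<in> \<sigma> m" "b $ m \<in> \<sigma> m" for m
    using ab by (auto simp: fibre_product_def)
  moreover have "f (a $ m) = f (b $ m)" for m
    using ab eq unfolding fibre_product_def by (metis (mono_tags, lifting) mem_Collect_eq)
  ultimately have "a $ m = b $ m" for m
    using inj[OF assms] by (meson inj_onD)
  then show "a = b" by (simp add: vec_eq_iff)
qed

text \<open>Since all factors have the same image \<open>T\<close>, a point of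
  \<open>\<sigma> l\<close> has a partner with the same value in every other factor.\<close>

lemma fibre_product_nth:
  assumes "\<And>m. f ` \<sigma> m = T"
  shows "(\<lambda>z. z $ l) ` fibre_product f \<sigma> = \<sigma> l"
proof
  show "(\<lambda>z. z $ l) ` fibre_product f \<sigma> \<subseteq> \<sigma> l" by (auto simp: fibre_product_def)
  show "\<sigma> l \<subseteq> (\<lambda>z. z $ l) ` fibre_product f \<sigma>"
  proof
    fix x assume x: "x \<in> \<sigma> l"
    have "\<exists>y\<in>\<sigma> m. f y = f x" for m using assms[of m] assms[of l] x by (metis imageE imageI)
    then obtain g where g: "\<And>m. g m \<in> \<sigma> m" "\<And>m. f (g m) = f x" by metis
    define z where "z = (\<chi> m. if m = l then x else g m)"
    have "z \<in> fibre_product f \<sigma>" "z $ l = x" using g x by (auto simp: fibre_product_def z_def)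
    then show "x \<in> (\<lambda>z. z $ l) ` fibre_product f \<sigma>" by blast
  qed
qed

text \<open>A linear map carries the relative interior of a convex set onto that of its image;
  injectivity of the projection identifies the preimage found there with \<open>x\<close>.\<close>

lemma rel_interior_fibre_product:
  fixes \<sigma> :: "'k::finite \<Rightarrow> 'a set"
  assumes \<sigma>: "\<And>l. \<sigma> l \<in> K" "\<And>l. f ` \<sigma> l = T"
    and x: "x \<in> fibre_product f \<sigma>" "x $ l \<in> rel_interior (\<sigma> l)"
  shows "x \<in> rel_interior (fibre_product f \<sigma>)"
proof -
  have "(\<lambda>z. z $ l) ` rel_interior (fibre_product f \<sigma>) = rel_interior (\<sigma> l)"
    using rel_interior_convex_linear_image[OF _ convex_fibre_product[of \<sigma>, OF \<sigma>(1)], of "\<lambda>z. z $ l"]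
      fibre_product_nth[of \<sigma>, OF \<sigma>(2)] by (simp add: bounded_linear.linear[OF bounded_linear_vec_nth])
  then obtain z where z: "z \<in> rel_interior (fibre_product f \<sigma>)" "z $ l = x $ l"
    using x(2) by (metis imageE)
  then have "z = x"
    using inj_on_fibre_product_nth[of \<sigma>, OF \<sigma>(1)] x(1) rel_interior_subset by (metis inj_onD subsetD)
  then show ?thesis using z(1) by simp
qed

text \<open>The face condition on open segments is checked in each coordinate, where
  \<open>\<sigma> l \<inter> \<tau> l\<close> is a face of \<open>\<sigma> l\<close>.\<close>

lemma fibre_product_inter_face:
  fixes \<sigma> \<tau> :: "'k::finite \<Rightarrow> 'a set"
  assumes \<sigma>: "\<And>l. \<sigma> l \<in> K" and \<tau>: "\<And>l. \<tau> l \<in> K"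
  shows "fibre_product f \<sigma> \<inter> fibre_product f \<tau> face_of fibre_product f \<sigma>"
proof -
  have ends: "a \<in> fibre_product f \<tau>"
    if ab: "a \<in> fibre_product f \<sigma>" "b \<in> fibre_product f \<sigma>"
      and c: "c \<in> fibre_product f \<sigma>" "c \<in> fibre_product f \<tau>" "c \<in> open_segment a b" for a b c
  proof -
    obtain u where u: "0 < u" "u < 1" "c = (1 - u) *\<^sub>R a + u *\<^sub>R b"
      using c(3) by (auto simp: in_segment)
    have "a $ l \<in> \<tau> l" for l
    \<comment> \<open>A segment may collapse to a point in one coordinate. Its open segment is then
      empty and the face property says nothing, but \<open>a $ l\<close> equals
      \<open>c $ l\<close>.\<close>
    proof (cases "a $ l = b $ l")
      case True
      then have "c $ l = a $ l" using u(3) by (simp flip: scaleR_left_distrib)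
      then show ?thesis using c(2) by (auto simp: fibre_product_def dest: spec[of _ l])
    next
      case False
      then have "c $ l \<in> open_segment (a $ l) (b $ l)" using u by (auto simp: in_segment)
      moreover have "\<sigma> l \<inter> \<tau> l face_of \<sigma> l" using K \<sigma> \<tau> by (auto simp: geometric_complex_def)
      moreover have "a $ l \<in> \<sigma> l" "b $ l \<in> \<sigma> l" "c $ l \<in> \<sigma> l \<inter> \<tau> l"
        using ab c by (auto simp: fibre_product_def)
      ultimately show ?thesis using face_ofD by blast
    qed
    then show ?thesis using ab(1) by (auto simp: fibre_product_def)
  qed
  have "convex (fibre_product f \<sigma> \<inter> fibre_product f \<tau>)"
    using assms by (intro convex_Int convex_fibre_product)
  moreover have "a \<in> fibre_product f \<sigma> \<inter> fibre_product f \<tau> \<and>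
      b \<in> fibre_product f \<sigma> \<inter> fibre_product f \<tau>"
    if "a \<in> fibre_product f \<sigma>" "b \<in> fibre_product f \<sigma>" "c \<in> fibre_product f \<sigma> \<inter> fibre_product f \<tau>"
      "c \<in> open_segment a b" for a b c
    using ends[of a b c] ends[of b a c] that open_segment_commute[of a b] by auto
  ultimately show ?thesis
    unfolding face_of_def by blast
qed

section \<open>The simplex attached to a point of the multi-point space\<close>

lemma lifted_vertex_eq:
  assumes "x \<in> \<Union>K" "v \<in> vertices (carrier_simplex K x)"
  shows "lifted_vertex K f x (f v) = v"
  unfolding lifted_vertex_def
proof (rule the_equality)
  fix w assume "w \<in> vertices (carrier_simplex K x) \<and> f w = f v"
  then show "w = v"
    using inj[OF carrier_simplex(1)[OF K assms(1)]] assms(2) vertices_subset by (metis inj_onD subsetD)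
qed (use assms(2) in auto)

context
  fixes x :: "'a ^ 'k::finite"
  assumes x: "x \<in> multi_point_space (\<Union>K) f"
begin

lemma mem_nth: "x $ l \<in> \<Union>K"
  using x by (simp add: multi_point_space_def)

lemma carriers:
  shows "carrier_simplex K (x $ l) \<in> K"
    and "f ` carrier_simplex K (x $ l) = carrier_simplex L (common_value f x)"
proof -
  show "carrier_simplex K (x $ l) \<in> K" by (rule carrier_simplex(1)[OF K mem_nth])
  have "common_value f x = f (x $ l)"
    using x by (intro common_value_eq) (simp add: multi_point_space_def)
  then show "f ` carrier_simplex K (x $ l) = carrier_simplex L (common_value f x)"
    using carrier_simplex_image[OF mem_nth[of l]] by simp
qed

lemma mem_rel_interior_fibre_product:
  "x \<in> rel_interior (fibre_product f (\<lambda>l. carrier_simplex K (x $ l)))"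
proof (rule rel_interior_fibre_product[of "\<lambda>l. carrier_simplex K (x $ l)", OF carriers])
  show "x \<in> fibre_product f (\<lambda>l. carrier_simplex K (x $ l))"
    using x mem_carrier_simplex[OF K mem_nth]
    by (auto simp: fibre_product_def multi_point_space_def)
qed (rule carrier_simplex(2)[OF K mem_nth])

text \<open>The hull of the lifted vertices lies in the fibre product, and a projection that is
  injective there maps both onto the same carrier, so they coincide. The same projection matches the
  lifted vertices with those of the carrier, which yields affine independence and the
  dimension.\<close>

lemma multi_simplex:
  shows "multi_simplex K L f x = fibre_product f (\<lambda>l. carrier_simplex K (x $ l))" (is "_ = ?P")
    and "\<exists>n::nat. int n simplex multi_simplex K L f x"
proof -
  \<comment> \<open>Any coordinate will do; one exists because types are nonempty, which encodes
    \<open>k \<ge> 1\<close>.\<close>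
  fix l :: 'k
  let ?\<sigma> = "\<lambda>m. carrier_simplex K (x $ m)"
  let ?T = "carrier_simplex L (common_value f x)"
  let ?\<pi> = "\<lambda>z :: 'a ^ 'k. z $ l"
  define V where "V = {(\<chi> m. lifted_vertex K f (x $ m) w) | w. w \<in> vertices ?T}"
  have lin: "linear ?\<pi>" by (rule bounded_linear.linear[OF bounded_linear_vec_nth])
  have vT: "vertices ?T = f ` vertices (?\<sigma> m)" for m
    using image_simplex(2)[OF carriers(1)] carriers(2) by metis
  have lift: "lifted_vertex K f (x $ m) w \<in> vertices (?\<sigma> m)"
    "f (lifted_vertex K f (x $ m) w) = w" if "w \<in> vertices ?T" for w m
    using that lifted_vertex_eq[OF mem_nth[of m]] unfolding vT[of m] by auto
  have "V \<subseteq> ?P"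
    using lift vertices_subset unfolding V_def fibre_product_def by fastforce
  then have hull_sub: "convex hull V \<subseteq> ?P"
    using convex_fibre_product[OF carriers(1)] by (intro hull_minimal) auto
  have "?\<pi> ` V = vertices (?\<sigma> l)"
  proof
    show "?\<pi> ` V \<subseteq> vertices (?\<sigma> l)" using lift by (auto simp: V_def)
    show "vertices (?\<sigma> l) \<subseteq> ?\<pi> ` V"
    proof
      fix v assume v: "v \<in> vertices (?\<sigma> l)"
      then have "(\<chi> m. lifted_vertex K f (x $ m) (f v)) \<in> V" using vT by (auto simp: V_def)
      then show "v \<in> ?\<pi> ` V" using lifted_vertex_eq[OF mem_nth v] by force
    qed
  qed
  note \<pi>V = this
  have inj\<pi>: "inj_on ?\<pi> ?P" by (rule inj_on_fibre_product_nth[OF carriers(1)])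
  have "?\<pi> ` (convex hull V) = ?\<sigma> l"
    using convex_hull_linear_image[OF lin, of V] \<pi>V geometric_complex_vertices(2)[OF K carriers(1)]
    by simp
  then have "?\<pi> ` (convex hull V) = ?\<pi> ` ?P"
    using fibre_product_nth[of "?\<sigma>", OF carriers(2)] by simp
  then have "convex hull V = ?P"
    using inj_on_image_eq_iff[OF inj\<pi> hull_sub] by simp
  moreover have ms: "multi_simplex K L f x = convex hull V"
    by (simp add: multi_simplex_def V_def)
  ultimately show "multi_simplex K L f x = ?P" by simp
  have injV: "inj_on ?\<pi> V" using inj\<pi> \<open>V \<subseteq> ?P\<close> by (rule inj_on_subset)
  then have "\<not> affine_dependent V"
    using affine_independent_inj_linear_image[OF lin] \<pi>V geometric_complex_vertices(1)[OF K carriers(1)]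
    by simp
  moreover obtain n :: nat where "int n simplex ?\<sigma> l"
    using geometric_complex_simplex[OF K carriers(1)] .
  then have "int (card V) = int n + 1"
    using simplex_vertices(3) \<pi>V card_image[OF injV] by metis
  ultimately show "\<exists>n::nat. int n simplex multi_simplex K L f x"
    unfolding ms simplex_def by blast
qed

lemma mem_rel_interior_multi_simplex: "x \<in> rel_interior (multi_simplex K L f x)"
  using mem_rel_interior_fibre_product multi_simplex(1) by simp

lemma multi_simplex_subset: "multi_simplex K L f x \<subseteq> multi_point_space (\<Union>K) f"
  using carriers(1) by (auto simp: multi_simplex(1) fibre_product_def multi_point_space_def)

end

section \<open>The complex formed by these simplices\<close>

lemma multi_simplex_inter_face:
  assumes "x \<in> multi_point_space (\<Union>K) f" "y \<in> multi_point_space (\<Union>K) f"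
  shows "multi_simplex K L f x \<inter> multi_simplex K L f y face_of multi_simplex K L f x"
  using assms by (simp add: multi_simplex(1) fibre_product_inter_face carriers(1))

lemma geometric_complex_multi_simplex:
  "geometric_complex (multi_simplex K L f ` (multi_point_space (\<Union>K) f :: ('a ^ 'k::finite) set))"
    (is "geometric_complex (?M ` ?W)")
  unfolding geometric_complex_def
proof (intro conjI ballI allI impI)
  fix S assume "S \<in> ?M ` ?W"
  then show "\<exists>n::nat. int n simplex S" using multi_simplex(2) by blast
next
  fix S F assume "S \<in> ?M ` ?W" and F: "F face_of S \<and> F \<noteq> {}"
  then obtain x where x: "x \<in> ?W" "S = ?M x" by blast
  \<comment> \<open>A face \<open>F\<close> is recognised as the simplex of any point
    \<open>y\<close> in its relative interior.\<close>
  have "rel_interior F \<noteq> {}"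
    using F face_of_imp_convex rel_interior_eq_empty by blast
  then obtain y where y: "y \<in> rel_interior F" by blast
  then have "y \<in> S" using F face_of_imp_subset rel_interior_subset by blast
  then have yW: "y \<in> ?W" using x multi_simplex_subset by blast
  have meet: "y \<in> rel_interior (?M y)" by (rule mem_rel_interior_multi_simplex[OF yW])
  \<comment> \<open>This face of \<open>?M y\<close> contains \<open>y\<close>, a relative interior
    point, so \<open>?M y\<close> lies in \<open>S\<close>. Then \<open>F\<close> and
    \<open>?M y\<close> are faces of \<open>S\<close> whose relative interiors share
    \<open>y\<close>, hence equal.\<close>
  have "?M y \<inter> S face_of ?M y" using x yW multi_simplex_inter_face by blast
  then have "?M y \<inter> S = ?M y"
    using face_of_disjoint_rel_interior meet rel_interior_subset \<open>y \<in> S\<close> by blast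
  then have "?M y face_of S"
    using x multi_simplex_inter_face[OF x(1) yW] by (simp add: Int_commute)
  then have "F = ?M y" using F y meet by (intro face_of_eq[of F S]) auto
  then show "F \<in> ?M ` ?W" using yW by blast
next
  fix S S' assume "S \<in> ?M ` ?W" "S' \<in> ?M ` ?W"
  then show "S \<inter> S' face_of S" "S \<inter> S' face_of S'"
    using multi_simplex_inter_face by (auto simp: Int_commute)
qed

lemma Union_multi_simplex:
  "\<Union>(multi_simplex K L f ` multi_point_space (\<Union>K) f) = multi_point_space (\<Union>K) f"
  using multi_simplex_subset subsetD[OF rel_interior_subset mem_rel_interior_multi_simplex] by blast

section \<open>Local finiteness and the weak topology\<close>

lemma multi_simplex_locally_finite:
  fixes x :: "'a ^ 'k::finite"
  assumes lf: "locally_finite_complex K" and x: "x \<in> multi_point_space (\<Union>K) f"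
  obtains U where "open U" "x \<in> U"
    "finite {S \<in> multi_simplex K L f ` multi_point_space (\<Union>K) f. S \<inter> U \<noteq> {}}"
proof -
  have "\<exists>U. open U \<and> x $ l \<in> U \<and> finite {S\<in>K. S \<inter> U \<noteq> {}}" for l
    using lf mem_nth[OF x, of l] unfolding locally_finite_complex_def by blast
  then obtain N where N: "\<And>l. open (N l)" "\<And>l. x $ l \<in> N l" "\<And>l. finite {S\<in>K. S \<inter> N l \<noteq> {}}"
    by metis
  \<comment> \<open>The box of the neighbourhoods \<open>N l\<close>: a simplex meeting
    \<open>U\<close> has its \<open>l\<close>-th carrier meeting \<open>N l\<close>.\<close>
  define U :: "('a ^ 'k) set" where "U = (\<Inter>l. (\<lambda>z. z $ l) -` N l)"
  have "open U" unfolding U_def using N(1) by (intro open_INT) (auto intro: open_vimage_vec_nth)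
  moreover have "x \<in> U" using N(2) by (simp add: U_def)
  moreover have "finite {S \<in> multi_simplex K L f ` multi_point_space (\<Union>K) f. S \<inter> U \<noteq> {}}"
  proof (rule finite_subset)
    let ?F = "\<Pi>\<^sub>E l\<in>UNIV. {S\<in>K. S \<inter> N l \<noteq> {}}"
    \<comment> \<open>There are finitely many choices in each of finitely many coordinates, and the
      family of carriers determines the simplex.\<close>
    show "finite (fibre_product f ` ?F)" using N(3) by (intro finite_imageI finite_PiE) auto
    show "{S \<in> multi_simplex K L f ` multi_point_space (\<Union>K) f. S \<inter> U \<noteq> {}} \<subseteq> fibre_product f ` ?F"
    proof
      fix S assume "S \<in> {S \<in> multi_simplex K L f ` multi_point_space (\<Union>K) f. S \<inter> U \<noteq> {}}"
      then obtain y z where y: "y \<in> multi_point_space (\<Union>K) f" "S = multi_simplex K L f y"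
        and z: "z \<in> multi_simplex K L f y" "z \<in> U" by blast
      have "z $ l \<in> carrier_simplex K (y $ l) \<inter> N l" for l
        using z by (auto simp: multi_simplex(1)[OF y(1)] fibre_product_def U_def)
      then have "(\<lambda>l. carrier_simplex K (y $ l)) \<in> ?F"
        using carriers(1)[OF y(1)] by blast
      then show "S \<in> fibre_product f ` ?F"
        using multi_simplex(1)[OF y(1)] y(2) by simp
    qed
  qed
  ultimately show thesis using that by blast
qed

lemma simplicial_structure_on_multi_point_space:
  assumes lf: "locally_finite_complex K"
  shows "simplicial_structure_on (multi_simplex K L f ` multi_point_space (\<Union>K) f)
    (multi_point_space (\<Union>K) f :: ('a ^ 'k::finite) set)"
    (is "simplicial_structure_on ?M ?W")
  unfolding simplicial_structure_on_def
proof (intro conjI allI impI iffI ballI)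
  show cx: "geometric_complex ?M" by (rule geometric_complex_multi_simplex)
  show un: "\<Union>?M = ?W" by (rule Union_multi_simplex)
  fix A assume AW: "A \<subseteq> ?W"
  {
    fix S assume "closedin (top_of_set ?W) A" and S: "S \<in> ?M"
    then obtain C where "closed C" "A = ?W \<inter> C" using closedin_closed by blast
    moreover have "S \<subseteq> ?W" using S un by blast
    ultimately have "A \<inter> S = C \<inter> S" by blast
    then show "closed (A \<inter> S)"
      using \<open>closed C\<close> geometric_complex_compact[OF cx S] by (simp add: closed_Int compact_imp_closed)
  }
  assume closed: "\<forall>S\<in>?M. closed (A \<inter> S)"
  \<comment> \<open>Near \<open>x\<close> only finitely many simplices occur, so there
    \<open>A\<close> is contained in a finite union of closed pieces \<open>A \<inter> S\<close>;
    this union is closed and lies in \<open>A\<close>.\<close>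
  have "x \<in> A" if x: "x \<in> ?W" "x \<in> closure A" for x
  proof -
    obtain U where U: "open U" "x \<in> U" "finite {S \<in> ?M. S \<inter> U \<noteq> {}}"
      using multi_simplex_locally_finite[OF lf x(1)] .
    let ?B = "\<Union>S\<in>{S \<in> ?M. S \<inter> U \<noteq> {}}. A \<inter> S"
    have "U \<inter> A \<subseteq> ?B"
    proof
      fix z assume z: "z \<in> U \<inter> A"
      then have "z \<in> \<Union>?M" using AW by (simp only: un) blast
      then obtain S where "S \<in> ?M" "z \<in> S" by (rule UnionE)
      then show "z \<in> ?B" using z by blast
    qed
    moreover have "closed ?B" using U(3) closed by (intro closed_UN) auto
    ultimately have "closure (U \<inter> A) \<subseteq> ?B" by (rule closure_minimal)
    \<comment> \<open>As \<open>U\<close> is open, a point of \<open>U\<close> in the closure of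
      \<open>A\<close> is in the closure of \<open>U \<inter> A\<close>.\<close>
    then show ?thesis using open_Int_closure_subset[OF U(1)] U(2) x(2) by blast
  qed
  then have "A = ?W \<inter> closure A" using AW closure_subset by blast
  then show "closedin (top_of_set ?W) A" using closedin_closed_Int[OF closed_closure] by metis
qed

end

section \<open>Finite fibres\<close>

text \<open>Two distinct points of \<open>S\<close> with equal value would put the whole segment
  between them, an infinite set, into one fibre.\<close>

lemma simplicial_map_finite_fibres_inj_on:
  fixes f :: "'a::euclidean_space \<Rightarrow> 'b::euclidean_space"
  assumes K: "geometric_complex K" and f: "simplicial_map K L f"
    and fin: "\<And>x. x \<in> \<Union>K \<Longrightarrow> finite {x' \<in> \<Union>K. f x' = f x}" and S: "S \<in> K"
  shows "inj_on f S"
proof (rule inj_onI, rule ccontr)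
  fix a b assume ab: "a \<in> S" "b \<in> S" "f a = f b" "a \<noteq> b"
  obtain h c where h: "linear h" "\<forall>x\<in>S. f x = h x + c"
    using f S unfolding simplicial_map_def by blast
  have hab: "h a = h b" using h(2) ab by auto
  have "closed_segment a b \<subseteq> {x \<in> \<Union>K. f x = f a}"
  proof
    fix z assume z: "z \<in> closed_segment a b"
    then have "z \<in> S"
      using ab geometric_complex_convex[OF K S] closed_segment_subset by blast
    moreover obtain u where "z = (1 - u) *\<^sub>R a + u *\<^sub>R b" using z by (auto simp: in_segment)
    then have "h z = h a" using h(1) hab
      by (simp add: linear_add linear_scale flip: scaleR_left_distrib)
    ultimately show "z \<in> {x \<in> \<Union>K. f x = f a}" using h(2) ab(1) S by auto
  qed
  moreover have "finite {x \<in> \<Union>K. f x = f a}" using fin ab(1) S by blast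
  ultimately show False using ab(4) finite_closed_segment finite_subset by metis
qed

theorem proposition4p6:
  fixes K :: "(real ^ 'n) set set" and L :: "(real ^ 'p) set set"
    and X :: "(real ^ 'n) set" and Y :: "(real ^ 'p) set"
    and f :: "real ^ 'n \<Rightarrow> real ^ 'p"
    and W :: "((real ^ 'n) ^ 'k) set"
  assumes "locally_finite_complex K" and "X = \<Union>K"
    and "locally_finite_complex L" and "Y = \<Union>L"
    and "simplicial_map K L f"
    and "f ` X = Y"
    and "\<And>y. y \<in> Y \<Longrightarrow> finite {x \<in> X. f x = y}"
    and "W = multi_point_space X f"
  shows "simplicial_structure_on (multi_simplex K L f ` W) W"
proof -
  interpret simplexwise_injective_map K L f
  proof
    show "geometric_complex K" "geometric_complex L" "simplicial_map K L f"
      using assms by (auto simp: locally_finite_complex_def)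
    then show "inj_on f S" if "S \<in> K" for S
      using simplicial_map_finite_fibres_inj_on[OF _ _ _ that] assms(2,6,7) by blast
  qed
  show ?thesis
    unfolding assms(8,2) by (rule simplicial_structure_on_multi_point_space[OF assms(1)])
qed

end
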